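(* Let $\mathcal Q$ be a logic on a Hilbert space $\mathcal H$. For any $u_1,\ldots,u_n\in\mathbf R^{(\mathcal Q)}$, $$[\![u_1=u_2\wedge\cdots\wedge u_{n-1}=u_n]\!]\le\underline{\mathrm{Or}}(u_1,\ldots,u_n).$$
   Context: $\mathcal Q(\mathcal H)$ is the lattice of orthogonal projections on $\mathcal H$ (order by inclusion of ranges, $\wedge,\vee$ and arbitrary $\bigwedge,\bigvee$ via intersection / closed span of union of ranges, $P^\perp=1-P$). $\mathcal A^!=\{P\in\mathcal Q(\mathcal H):PQ=QP\ \forall Q\in\mathcal A\}$; a logic is $\mathcal Q\subseteq\mathcal Q(\mathcal H)$ with $\mathcal Q=\mathcal Q^{!!}$. $P\Rightarrow Q=P^\perp\vee(P\wedge Q)$, $P\Leftrightarrow Q=(P\Rightarrow Q)\wedge(Q\Rightarrow P)$. $\mathrm{cdom}(\mathcal A)=\bigvee\{E\in\mathcal A^!:(P_1\wedge E)(P_2\wedge E)=(P_2\wedge E)(P_1\wedge E)\ \forall P_1,P_2\in\mathcal A\}$. $V^{(\mathcal Q)}=\bigcup_\alpha V^{(\mathcal Q)}_\alpha$, $V^{(\mathcal Q)}_\alpha$ the set of functions $u$ with values in $\mathcal Q$ and $\mathrm{dom}(u)\subseteq\bigcup_{\beta<\alpha}V^{(\mathcal Q)}_\beta$. Support $L(u)=\bigcup_{x\in\mathrm{dom}(u)}L(x)\cup\{u(x):x\in\mathrm{dom}(u)\}$; $\underline{\mathrm{Or}}(u_1,\ldots,u_n)=\mathrm{cdom}(L(u_1)\cup\cdots\cup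 L(u_n))$. Truth values: $[\![u=v]\!]=\bigwedge_{u'\in\mathrm{dom}(u)}(u(u')\Rightarrow[\![u'\in v]\!])\wedge\bigwedge_{v'\in\mathrm{dom}(v)}(v(v')\Rightarrow[\![v'\in u]\!])$, $[\![u\in v]\!]=\bigvee_{v'\in\mathrm{dom}(v)}(v(v')\wedge[\![u=v']\!])$, $[\![\neg\phi]\!]=[\![\phi]\!]^\perp$, connectives by lattice operations, $[\![(\forall x\in u)\phi]\!]=\bigwedge_{u'\in\mathrm{dom}(u)}(u(u')\Rightarrow[\![\phi(u')]\!])$, $[\![(\exists x\in u)\phi]\!]=\bigvee_{u'\in\mathrm{dom}(u)}(u(u')\wedge[\![\phi(u')]\!])$. For a set $v$, $\check v=\{(\check w,1):w\in v\}$; $\mathbf Q$ is the rationals. $\mathbf R(x)$ is $x\subseteq\check{\mathbf Q}\wedge\exists y\in\check{\mathbf Q}(y\in x)\wedge\exists y\in\check{\mathbf Q}(y\notin x)\wedge\forall y\in\check{\mathbf Q}(y\in x\Leftrightarrow\forall z\in\check{\mathbf Q}(y<z\Rightarrow z\in x))$ ($x\subseteq y$ abbreviates $\forall z\in x(z\in y)$, $<$ the order of rationals); $\mathbf R^{(\mathcal Q)}=\{u\in V^{(\mathcal Q)}:\mathrm{dom}(u)=\{\check r:r\in\mathbf Q\},\ [\![\mathbf R(u)]\!]=1\}$. *)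

theory Defs
  imports "HOL-Analysis.Analysis" "HOL-Library.Countable_Set_Type" "HOL-Library.Multiset"
begin

unbundle lattice_syntax

section \<open>Complex Hilbert spaces\<close>

text \<open>The inner product is conjugate-linear in its first argument.  The real part of \<open>cinner\<close> is
  the real inner product of the underlying real inner product space, so that positivity and
  compatibility with the norm are inherited from \<^class>\<open>real_inner\<close>.\<close>

class complex_inner = real_inner +
  fixes scaleC :: "complex \<Rightarrow> 'a \<Rightarrow> 'a"
    and cinner :: "'a \<Rightarrow> 'a \<Rightarrow> complex"
  assumes scaleC_add_right: "scaleC a (x + y) = scaleC a x + scaleC a y"
    and scaleC_add_left: "scaleC (a + b) x = scaleC a x + scaleC b x"
    and scaleC_scaleC: "scaleC a (scaleC b x) = scaleC (a * b) x"
    and scaleC_of_real: "scaleC (complex_of_real r) x = scaleR r x"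
    and cinner_commute: "cinner x y = cnj (cinner y x)"
    and cinner_add_right: "cinner x (y + z) = cinner x y + cinner x z"
    and cinner_scaleC_right: "cinner x (scaleC a y) = a * cinner x y"
    and inner_eq_Re_cinner: "inner x y = Re (cinner x y)"

class chilbert_space = complex_inner + complete_space

lemma cinner_add_left: "cinner (x + y) z = cinner x z + cinner y z"
  by (metis cinner_add_right cinner_commute complex_cnj_add)

lemma cinner_scaleC_left: "cinner (scaleC a x) y = cnj a * cinner x y"
  by (metis cinner_scaleC_right cinner_commute complex_cnj_mult)

lemma scaleC_minus1: "scaleC (- 1) x = - (x :: 'a :: complex_inner)"
  using scaleC_of_real[of "-1" x] by simp

lemma cinner_minus_right: "cinner x (- y) = - cinner x y"
  by (metis cinner_scaleC_right scaleC_minus1 mult_minus1)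

lemma cinner_minus_left: "cinner (- x) y = - cinner x y"
  by (metis cinner_minus_right cinner_commute complex_cnj_minus)

lemma cinner_diff_right: "cinner x (y - z) = cinner x y - cinner x z"
  using cinner_add_right[of x y "- z"] by (simp add: cinner_minus_right)

lemma cinner_diff_left: "cinner (x - y) z = cinner x z - cinner y z"
  using cinner_add_left[of x "- y" z] by (simp add: cinner_minus_left)

lemma cinner_zero_right [simp]: "cinner x 0 = 0"
  using cinner_diff_right[of x 0 0] by simp

lemma cinner_zero_left [simp]: "cinner 0 x = 0"
  using cinner_diff_left[of 0 0 x] by simp

lemma scaleC_diff_right: "scaleC a (x - y) = scaleC a x - scaleC a (y :: 'a :: complex_inner)"
  by (metis add_diff_cancel_right' diff_add_cancel scaleC_add_right)

lemma scaleC_zero_right [simp]: "scaleC a 0 = (0 :: 'a :: complex_inner)"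
  using scaleC_diff_right[of a 0 "0 :: 'a"] by simp

lemma cinner_self_eq_0: "cinner x x = 0 \<Longrightarrow> x = 0"
  by (metis inner_eq_Re_cinner inner_eq_zero_iff zero_complex.simps(1))

lemma bounded_linear_scaleC: "bounded_linear (scaleC a :: 'a \<Rightarrow> 'a :: complex_inner)"
proof (rule bounded_linear_intro)
  show "scaleC a (x + y) = scaleC a x + scaleC a y" for x y :: 'a
    by (rule scaleC_add_right)
  show "scaleC a (r *\<^sub>R x) = r *\<^sub>R scaleC a x" for r and x :: 'a
    unfolding scaleC_of_real[symmetric] scaleC_scaleC by (simp add: mult.commute)
  show "norm (scaleC a x) \<le> norm x * cmod a" for x :: 'a
  proof -
    have "cinner (scaleC a x) (scaleC a x) = (cnj a * a) * cinner x x"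
      by (simp add: cinner_scaleC_left cinner_scaleC_right)
    also have "\<dots> = complex_of_real ((cmod a)\<^sup>2) * cinner x x"
      by (simp only: complex_norm_square mult.commute)
    finally have "inner (scaleC a x) (scaleC a x) = (cmod a)\<^sup>2 * inner x x"
      by (simp add: inner_eq_Re_cinner del: of_real_power)
    hence "(norm (scaleC a x))\<^sup>2 = (norm x * cmod a)\<^sup>2"
      by (simp add: power2_norm_eq_inner power_mult_distrib mult.commute)
    thus ?thesis by (simp add: power2_eq_iff_nonneg)
  qed
qed

section \<open>Closed subspaces and the projection theorem\<close>

definition closed_csubspace :: "'a :: complex_inner set \<Rightarrow> bool" where
  "closed_csubspace M \<longleftrightarrow>
     closed M \<and> 0 \<in> M \<and> (\<forall>x\<in>M. \<forall>y\<in>M. x + y \<in> M) \<and> (\<forall>a. \<forall>x\<in>M. scaleC a x \<in> M)"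

definition is_projection :: "('a :: complex_inner \<Rightarrow> 'a) \<Rightarrow> bool" where
  "is_projection P \<longleftrightarrow>
     bounded_linear P \<and> (\<forall>a x. P (scaleC a x) = scaleC a (P x)) \<and>
     P \<circ> P = P \<and> (\<forall>x y. cinner (P x) y = cinner x (P y))"

lemma closed_csubspaceD:
  assumes "closed_csubspace M"
  shows "closed M" "0 \<in> M" "x \<in> M \<Longrightarrow> y \<in> M \<Longrightarrow> x + y \<in> M" "x \<in> M \<Longrightarrow> scaleC a x \<in> M"
    "x \<in> M \<Longrightarrow> - x \<in> M" "x \<in> M \<Longrightarrow> y \<in> M \<Longrightarrow> x - y \<in> M" "x \<in> M \<Longrightarrow> r *\<^sub>R x \<in> M"
proof -
  show 1: "closed M" "0 \<in> M" and add: "\<And>x y. x \<in> M \<Longrightarrow> y \<in> M \<Longrightarrow> x + y \<in> M"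
    and sc: "\<And>x a. x \<in> M \<Longrightarrow> scaleC a x \<in> M"
    using assms by (auto simp: closed_csubspace_def)
  show m: "- x \<in> M" if "x \<in> M" for x
    using sc[OF that, of "-1"] by (simp add: scaleC_minus1)
  show "x - y \<in> M" if "x \<in> M" "y \<in> M"
    using add[OF that(1) m[OF that(2)]] by simp
  show "r *\<^sub>R x \<in> M" if "x \<in> M"
    using sc[OF that, of "of_real r"] by (simp add: scaleC_of_real)
qed

lemma parallelogram:
  fixes x y :: "'a :: real_inner"
  shows "(norm (x - y))\<^sup>2 = 2 * (norm x)\<^sup>2 + 2 * (norm y)\<^sup>2 - (norm (x + y))\<^sup>2"
  by (simp add: power2_norm_eq_inner inner_add_left inner_add_right inner_diff_left
      inner_diff_right inner_commute)

lemma closest_point_exists: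
  fixes M :: "'a :: chilbert_space set"
  assumes M: "closed_csubspace M"
  shows "\<exists>p\<in>M. \<forall>m\<in>M. norm (x - p) \<le> norm (x - m)"
proof -
  note MD = closed_csubspaceD[OF M]
  define d where "d = (INF m\<in>M. (norm (x - m))\<^sup>2)"
  have bdd: "bdd_below ((\<lambda>m. (norm (x - m))\<^sup>2) ` M)"
    by (rule bdd_belowI[of _ 0]) auto
  have ne: "M \<noteq> {}" using MD(2) by auto
  have d_le: "d \<le> (norm (x - m))\<^sup>2" if "m \<in> M" for m
    unfolding d_def by (rule cINF_lower[OF bdd that])
  have "\<exists>m\<in>M. (norm (x - m))\<^sup>2 < d + 1 / real (Suc n)" for n
  proof -
    have "d < d + 1 / real (Suc n)" by simp
    thus ?thesis
      unfolding d_def cINF_less_iff[OF ne bdd] .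
  qed
  then obtain f where f: "\<And>n. f n \<in> M" "\<And>n. (norm (x - f n))\<^sup>2 < d + 1 / real (Suc n)"
    by metis
  have close: "(norm (f m - f n))\<^sup>2 \<le> 2 / real (Suc m) + 2 / real (Suc n)" for m n
  proof -
    have "(norm ((x - f n) - (x - f m)))\<^sup>2 =
        2 * (norm (x - f n))\<^sup>2 + 2 * (norm (x - f m))\<^sup>2 - (norm ((x - f n) + (x - f m)))\<^sup>2"
      by (rule parallelogram)
    moreover have "(x - f n) + (x - f m) = 2 *\<^sub>R (x - (1/2) *\<^sub>R (f n + f m))"
      by (simp add: algebra_simps scaleR_2)
    hence "(norm ((x - f n) + (x - f m)))\<^sup>2 = 4 * (norm (x - (1/2) *\<^sub>R (f n + f m)))\<^sup>2"
      by (simp add: power_mult_distrib)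
    moreover have "d \<le> (norm (x - (1/2) *\<^sub>R (f n + f m)))\<^sup>2"
      by (intro d_le MD(7) MD(3) f)
    moreover have "(x - f n) - (x - f m) = f m - f n" by simp
    moreover have "2 / real (Suc k) = 2 * (1 / real (Suc k))" for k by simp
    ultimately show ?thesis using f(2)[of n] f(2)[of m] by (smt (verit, best))
  qed
  have "Cauchy f"
  proof (rule metric_CauchyI)
    fix e :: real assume e: "e > 0"
    obtain N where N: "4 / e\<^sup>2 < real N" using reals_Archimedean2 by blast
    show "\<exists>K. \<forall>m\<ge>K. \<forall>n\<ge>K. dist (f m) (f n) < e"
    proof (intro exI allI impI)
      fix m n assume mn: "m \<ge> N" "n \<ge> N"
      have "2 / real (Suc m) \<le> 2 / real (Suc N)" "2 / real (Suc n) \<le> 2 / real (Suc N)"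
        using mn by (auto intro!: divide_left_mono)
      hence "(norm (f m - f n))\<^sup>2 \<le> 4 / real (Suc N)" using close[of m n] by simp
      also have "\<dots> < e\<^sup>2"
      proof -
        have "4 < e\<^sup>2 * real N" using N e by (simp add: field_simps)
        also have "\<dots> \<le> e\<^sup>2 * real (Suc N)" by (intro mult_left_mono) auto
        finally show ?thesis by (simp add: field_simps)
      qed
      finally show "dist (f m) (f n) < e"
        using e by (simp add: dist_norm power_less_imp_less_base)
    qed
  qed
  then obtain p where p: "f \<longlonglongrightarrow> p"
    using Cauchy_convergent convergent_def by blast
  have pM: "p \<in> M" using closed_sequentially[OF MD(1)] f(1) p by blast
  have "(\<lambda>n. (norm (x - f n))\<^sup>2) \<longlonglongrightarrow> (norm (x - p))\<^sup>2"
    by (intro tendsto_intros p)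
  moreover have "(\<lambda>n. d + 1 / real (Suc n)) \<longlonglongrightarrow> d + 0"
    by (intro tendsto_add tendsto_const LIMSEQ_Suc lim_1_over_n)
  ultimately have "(norm (x - p))\<^sup>2 \<le> d + 0"
    by (rule LIMSEQ_le) (meson f(2) less_imp_le)
  hence *: "(norm (x - p))\<^sup>2 \<le> d" by simp
  have "norm (x - p) \<le> norm (x - m)" if "m \<in> M" for m
    by (rule power2_le_imp_le[OF order_trans[OF * d_le[OF that]] norm_ge_zero])
  thus ?thesis using pM by blast
qed

lemma closest_imp_orthogonal:
  fixes z :: "'a :: complex_inner"
  assumes M: "closed_csubspace M" and min: "\<And>m. m \<in> M \<Longrightarrow> norm z \<le> norm (z - m)" and m: "m \<in> M"
  shows "cinner z m = 0"
proof -
  note MD = closed_csubspaceD[OF M]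
  have re: "inner z m = 0" if m: "m \<in> M" for m
  proof (cases "m = 0")
    case False
    define t where "t = inner z m / inner m m"
    have pos: "inner m m > 0" using False by simp
    have "(norm z)\<^sup>2 \<le> (norm (z - t *\<^sub>R m))\<^sup>2"
      by (intro power_mono min MD(7) m) auto
    also have "\<dots> = (norm z)\<^sup>2 - 2 * t * inner z m + t\<^sup>2 * inner m m"
      unfolding power2_norm_eq_inner
      by (simp add: inner_diff_left inner_diff_right inner_commute[of m z]
          power2_eq_square algebra_simps)
    also have "\<dots> = (norm z)\<^sup>2 - (inner z m)\<^sup>2 / inner m m"
      using pos by (simp add: t_def power2_eq_square field_simps)
    finally have "(inner z m)\<^sup>2 / inner m m \<le> 0" by simp
    with pos have "(inner z m)\<^sup>2 \<le> 0" by (metis divide_le_0_iff not_le order_refl zero_le_power2)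
    thus ?thesis by simp
  qed simp
  have "Re (cinner z m) = 0" using re[OF m] by (simp add: inner_eq_Re_cinner)
  moreover have "Re (cinner z (scaleC \<i> m)) = 0"
    using re[OF MD(4)[OF m]] by (simp add: inner_eq_Re_cinner)
  hence "Im (cinner z m) = 0" by (simp add: cinner_scaleC_right)
  ultimately show ?thesis by (simp add: complex_eq_iff)
qed

lemma projection_exists:
  fixes M :: "'a :: chilbert_space set"
  assumes M: "closed_csubspace M"
  shows "\<exists>P. is_projection P \<and> range P = M"
proof -
  note MD = closed_csubspaceD[OF M]
  have "\<exists>p\<in>M. \<forall>m\<in>M. cinner (x - p) m = 0" for x
  proof -
    obtain p where p: "p \<in> M" "\<And>m. m \<in> M \<Longrightarrow> norm (x - p) \<le> norm (x - m)"
      using closest_point_exists[OF M] by blast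
    have "norm (x - p) \<le> norm (x - p - m)" if "m \<in> M" for m
      using p(2)[OF MD(3)[OF p(1) that]] by (simp add: diff_diff_eq)
    thus ?thesis using closest_imp_orthogonal[OF M] p(1) by blast
  qed
  then obtain P where P: "\<And>x. P x \<in> M" "\<And>x m. m \<in> M \<Longrightarrow> cinner (x - P x) m = 0"
    by metis
  have uniq: "P x = p" if "p \<in> M" "\<And>m. m \<in> M \<Longrightarrow> cinner (x - p) m = 0" for x p
  proof -
    have "p - P x \<in> M" by (intro MD(6) that P)
    hence "cinner (x - P x) (p - P x) = 0" "cinner (x - p) (p - P x) = 0"
      using P that by auto
    moreover have "p - P x = (x - P x) - (x - p)" by simp
    ultimately have "cinner (p - P x) (p - P x) = 0"
      by (metis cinner_diff_left diff_self)
    thus ?thesis using cinner_self_eq_0 by fastforce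
  qed
  have add: "P (x + y) = P x + P y" for x y
  proof (rule uniq)
    show "P x + P y \<in> M" by (intro MD(3) P)
    fix m assume "m \<in> M"
    moreover have "x + y - (P x + P y) = (x - P x) + (y - P y)" by simp
    ultimately show "cinner (x + y - (P x + P y)) m = 0"
      using P(2) by (metis add.right_neutral cinner_add_left)
  qed
  have sc: "P (scaleC a x) = scaleC a (P x)" for a x
  proof (rule uniq)
    show "scaleC a (P x) \<in> M" by (intro MD(4) P)
    fix m assume "m \<in> M"
    thus "cinner (scaleC a x - scaleC a (P x)) m = 0"
      using P(2) by (metis cinner_scaleC_left mult_zero_right scaleC_diff_right)
  qed
  have id: "P x = x" if "x \<in> M" for x
    by (rule uniq) (use that in auto)
  have sa: "cinner (P x) y = cinner x (P y)" for x y
  proof -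
    have "cinner (x - P x) (P y) = 0" by (intro P)
    moreover have "cinner (y - P y) (P x) = 0" by (intro P)
    hence "cinner (P x) (y - P y) = 0" by (metis cinner_commute complex_cnj_zero)
    ultimately show ?thesis by (simp add: cinner_diff_left cinner_diff_right)
  qed
  have bd: "norm (P x) \<le> norm x * 1" for x
  proof -
    have "inner (x - P x) (P x) = 0" using P(2)[OF P(1)] by (simp add: inner_eq_Re_cinner)
    hence "(norm (P x))\<^sup>2 = inner x (P x)"
      by (simp add: power2_norm_eq_inner inner_diff_left)
    also have "\<dots> \<le> norm x * norm (P x)" by (rule norm_cauchy_schwarz)
    finally show ?thesis
      by (cases "P x = 0") (auto simp: power2_eq_square)
  qed
  have "bounded_linear P"
    by (rule bounded_linear_intro[OF add _ bd]) (metis sc scaleC_of_real)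
  hence "is_projection P"
    using sc sa id P(1) by (auto simp: is_projection_def fun_eq_iff)
  moreover have "range P = M" using P(1) id by (auto simp: image_iff) metis
  ultimately show ?thesis by blast
qed

lemma is_projection_range_unique:
  assumes P: "is_projection P" and Q: "is_projection Q" and eq: "range P = range Q"
  shows "P = Q"
proof
  fix x
  have PQ: "P (Q y) = Q y" "Q (P y) = P y" for y
    using P Q eq unfolding is_projection_def fun_eq_iff o_def by (metis rangeE rangeI)+
  have "cinner y (P x) = cinner y (Q x)" for y
    using P Q PQ unfolding is_projection_def by metis
  hence "cinner (P x - Q x) (P x - Q x) = 0" by (simp add: cinner_diff_right)
  thus "P x = Q x" using cinner_self_eq_0 by fastforce
qed

lemma closed_csubspace_range:
  assumes P: "is_projection P"
  shows "closed_csubspace (range P)"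
proof -
  interpret bounded_linear P using P by (simp add: is_projection_def)
  have r: "range P = {x. P x = x}"
    using P by (auto simp: is_projection_def fun_eq_iff image_iff) metis
  have "closed {x. P x = x}"
    by (intro closed_Collect_eq continuous_intros linear_continuous_on bounded_linear_axioms)
  thus ?thesis
    using P by (auto simp: closed_csubspace_def r add zero is_projection_def)
qed

lemma closed_csubspace_Inter: "(\<And>M. M \<in> S \<Longrightarrow> closed_csubspace M) \<Longrightarrow> closed_csubspace (\<Inter>S)"
  by (auto simp: closed_csubspace_def)

lemma closed_csubspace_hull: "closed_csubspace (closed_csubspace hull A)"
  by (rule hull_in) (rule closed_csubspace_Inter, blast)

section \<open>The lattice of projections\<close>

typedef (overloaded) 'a proj = "{P :: 'a :: chilbert_space \<Rightarrow> 'a. is_projection P}"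
  morphisms proj_apply Abs_proj
proof -
  have "closed_csubspace {0 :: 'a}" by (auto simp: closed_csubspace_def)
  thus ?thesis using projection_exists by blast
qed

definition proj_ran :: "'a :: chilbert_space proj \<Rightarrow> 'a set" where
  "proj_ran P = range (proj_apply P)"

definition proj_onto :: "'a :: chilbert_space set \<Rightarrow> 'a proj" where
  "proj_onto M = (THE P. proj_ran P = M)"

lemma is_projection_proj_apply: "is_projection (proj_apply P)"
  using proj_apply by auto

lemma proj_ran_inject: "proj_ran P = proj_ran Q \<longleftrightarrow> P = Q"
  unfolding proj_ran_def
  by (metis is_projection_range_unique is_projection_proj_apply proj_apply_inject)

lemma closed_csubspace_ran: "closed_csubspace (proj_ran P)"
  by (simp add: proj_ran_def closed_csubspace_range is_projection_proj_apply)

lemma proj_ran_proj_onto: "closed_csubspace M \<Longrightarrow> proj_ran (proj_onto M) = M"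
proof -
  assume "closed_csubspace M"
  then obtain P where "is_projection P" "range P = M" using projection_exists by blast
  hence "proj_ran (Abs_proj P) = M" by (simp add: proj_ran_def Abs_proj_inverse)
  thus ?thesis unfolding proj_onto_def by (metis (mono_tags, lifting) proj_ran_inject theI)
qed

text \<open>In the suprema, \<open>closed_csubspace hull A\<close> is the closed linear span of \<open>A\<close>.\<close>

instantiation proj :: (chilbert_space) complete_lattice
begin

definition less_eq_proj :: "'a proj \<Rightarrow> 'a proj \<Rightarrow> bool" where
  "P \<le> Q \<longleftrightarrow> proj_ran P \<subseteq> proj_ran Q"

definition less_proj :: "'a proj \<Rightarrow> 'a proj \<Rightarrow> bool" where
  "P < Q \<longleftrightarrow> proj_ran P \<subset> proj_ran Q"

definition inf_proj :: "'a proj \<Rightarrow> 'a proj \<Rightarrow> 'a proj" where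
  "P \<sqinter> Q = proj_onto (proj_ran P \<inter> proj_ran Q)"

definition sup_proj :: "'a proj \<Rightarrow> 'a proj \<Rightarrow> 'a proj" where
  "P \<squnion> Q = proj_onto (closed_csubspace hull (proj_ran P \<union> proj_ran Q))"

definition Inf_proj :: "'a proj set \<Rightarrow> 'a proj" where
  "\<Sqinter>S = proj_onto (\<Inter>P\<in>S. proj_ran P)"

definition Sup_proj :: "'a proj set \<Rightarrow> 'a proj" where
  "\<Squnion>S = proj_onto (closed_csubspace hull (\<Union>P\<in>S. proj_ran P))"

definition top_proj :: "'a proj" where
  "\<top> = Abs_proj (\<lambda>x. x)"

definition bot_proj :: "'a proj" where
  "\<bottom> = Abs_proj (\<lambda>x. 0)"

lemma proj_ran_inf: "proj_ran (P \<sqinter> Q) = proj_ran P \<inter> proj_ran Q" for P Q :: "'a proj"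
proof -
  have "closed_csubspace (\<Inter>{proj_ran P, proj_ran Q})"
    by (rule closed_csubspace_Inter) (auto simp: closed_csubspace_ran)
  thus ?thesis by (simp add: inf_proj_def proj_ran_proj_onto)
qed

lemma proj_ran_Inf: "proj_ran (\<Sqinter>S) = (\<Inter>P\<in>S. proj_ran P)" for S :: "'a proj set"
  unfolding Inf_proj_def
  by (rule proj_ran_proj_onto, rule closed_csubspace_Inter) (auto simp: closed_csubspace_ran)

lemma proj_ran_sup: "proj_ran (P \<squnion> Q) = closed_csubspace hull (proj_ran P \<union> proj_ran Q)" for P Q :: "'a proj"
  unfolding sup_proj_def by (intro proj_ran_proj_onto closed_csubspace_hull)

lemma proj_ran_Sup: "proj_ran (\<Squnion>S) = closed_csubspace hull (\<Union>P\<in>S. proj_ran P)" for S :: "'a proj set"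
  unfolding Sup_proj_def by (intro proj_ran_proj_onto closed_csubspace_hull)

lemma proj_apply_top: "proj_apply \<top> = (\<lambda>x :: 'a. x)"
  unfolding top_proj_def by (rule Abs_proj_inverse) (auto simp: is_projection_def)

lemma proj_apply_bot: "proj_apply \<bottom> = (\<lambda>x :: 'a. 0)"
  unfolding bot_proj_def by (rule Abs_proj_inverse) (auto simp: is_projection_def)

lemma proj_ran_top: "proj_ran (\<top> :: 'a proj) = UNIV"
  by (simp add: proj_ran_def proj_apply_top)

lemma proj_ran_bot: "proj_ran (\<bottom> :: 'a proj) = {0}"
  by (auto simp: proj_ran_def proj_apply_bot)

instance
proof
  fix P Q R :: "'a proj" and S :: "'a proj set"
  show "P < Q \<longleftrightarrow> P \<le> Q \<and> \<not> Q \<le> P" by (auto simp: less_eq_proj_def less_proj_def)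
  show "P \<le> P" by (simp add: less_eq_proj_def)
  show "P \<le> Q \<Longrightarrow> Q \<le> R \<Longrightarrow> P \<le> R" by (auto simp: less_eq_proj_def)
  show "P \<le> Q \<Longrightarrow> Q \<le> P \<Longrightarrow> P = Q" by (auto simp: less_eq_proj_def simp flip: proj_ran_inject)
  show "P \<sqinter> Q \<le> P" "P \<sqinter> Q \<le> Q" by (auto simp: less_eq_proj_def proj_ran_inf)
  show "P \<le> Q \<Longrightarrow> P \<le> R \<Longrightarrow> P \<le> Q \<sqinter> R" by (auto simp: less_eq_proj_def proj_ran_inf)
  show "P \<le> P \<squnion> Q" "Q \<le> P \<squnion> Q"
    using hull_subset[of "proj_ran P \<union> proj_ran Q" closed_csubspace]
    unfolding less_eq_proj_def proj_ran_sup by auto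
  show "Q \<le> P \<Longrightarrow> R \<le> P \<Longrightarrow> Q \<squnion> R \<le> P"
    unfolding less_eq_proj_def proj_ran_sup by (simp add: hull_minimal closed_csubspace_ran)
  show "P \<in> S \<Longrightarrow> \<Sqinter>S \<le> P" by (auto simp: less_eq_proj_def proj_ran_Inf)
  show "(\<And>P. P \<in> S \<Longrightarrow> Q \<le> P) \<Longrightarrow> Q \<le> \<Sqinter>S" by (auto simp: less_eq_proj_def proj_ran_Inf)
  show "P \<in> S \<Longrightarrow> P \<le> \<Squnion>S"
    using hull_subset[of "\<Union>P\<in>S. proj_ran P" closed_csubspace]
    unfolding less_eq_proj_def proj_ran_Sup by auto
  show "(\<And>P. P \<in> S \<Longrightarrow> P \<le> Q) \<Longrightarrow> \<Squnion>S \<le> Q"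
    unfolding less_eq_proj_def proj_ran_Sup by (simp add: UN_least hull_minimal closed_csubspace_ran)
  show "\<Sqinter>{} = (\<top> :: 'a proj)" by (simp add: proj_ran_Inf proj_ran_top flip: proj_ran_inject)
  have "closed_csubspace {0 :: 'a}" by (auto simp: closed_csubspace_def)
  hence "closed_csubspace hull {} = {0 :: 'a}"
    by (intro hull_unique) (auto simp: closed_csubspace_def)
  thus "\<Squnion>{} = (\<bottom> :: 'a proj)" by (simp add: proj_ran_Sup proj_ran_bot flip: proj_ran_inject)
qed

end

text \<open>Unary minus is the orthocomplement.\<close>

instantiation proj :: (chilbert_space) uminus
begin

definition uminus_proj :: "'a proj \<Rightarrow> 'a proj" where
  "- P = Abs_proj (\<lambda>x. x - proj_apply P x)"

instance ..

end

lemma proj_apply_uminus: "proj_apply (- P) = (\<lambda>x. x - proj_apply P x)"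
proof -
  have "is_projection (\<lambda>x. x - proj_apply P x)"
    using is_projection_proj_apply[of P] unfolding is_projection_def
    by (simp add: bounded_linear_sub bounded_linear_ident linear_diff bounded_linear.linear
        scaleC_diff_right cinner_diff_left cinner_diff_right fun_eq_iff)
  thus ?thesis unfolding uminus_proj_def by (simp add: Abs_proj_inverse)
qed

definition commutes :: "'a :: chilbert_space proj \<Rightarrow> 'a proj \<Rightarrow> bool" where
  "commutes P Q \<longleftrightarrow> proj_apply P \<circ> proj_apply Q = proj_apply Q \<circ> proj_apply P"

definition commutant :: "'a :: chilbert_space proj set \<Rightarrow> 'a proj set" where
  "commutant A = {P. \<forall>Q\<in>A. commutes P Q}"

definition is_logic :: "'a :: chilbert_space proj set \<Rightarrow> bool" where
  "is_logic \<Q> \<longleftrightarrow> commutant (commutant \<Q>) = \<Q>"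

definition cdom :: "'a :: chilbert_space proj set \<Rightarrow> 'a proj" where
  "cdom A = \<Squnion>{E \<in> commutant A. \<forall>P\<^sub>1\<in>A. \<forall>P\<^sub>2\<in>A. commutes (P\<^sub>1 \<sqinter> E) (P\<^sub>2 \<sqinter> E)}"

definition qimp :: "'a :: chilbert_space proj \<Rightarrow> 'a proj \<Rightarrow> 'a proj" where
  "qimp P Q = - P \<squnion> (P \<sqinter> Q)"

definition qiff :: "'a :: chilbert_space proj \<Rightarrow> 'a proj \<Rightarrow> 'a proj" where
  "qiff P Q = qimp P Q \<sqinter> qimp Q P"

section \<open>Sets and projection-valued sets\<close>

text \<open>HOL has no type of all sets, so we use the hereditarily countable sets: \<open>hset\<close> is the type
  of hereditarily countable pure sets, and \<open>'p qset\<close> is the type of hereditarily countable graphs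
  with values in \<open>'p\<close>.  The usual constructions of the rationals from the natural numbers
  live in \<open>hset\<close>, and a function whose domain consists of the check names of the rationals
  is hereditarily countable, so restricting to \<open>'p qset\<close> loses no projection-valued real.
  The elements of \<open>'p qset\<close> need not be functions; that is imposed by \<open>qV\<close> below.\<close>

datatype hset = HSet (elts: "hset cset")

datatype 'p qset = QSet (graph: "('p qset \<times> 'p) cset")

definition qdom :: "'p qset \<Rightarrow> 'p qset set" where
  "qdom u = fst ` rcset (graph u)"

definition qval :: "'p qset \<Rightarrow> 'p qset \<Rightarrow> 'p" where
  "qval u x = (THE p. (x, p) \<in> rcset (graph u))"

text \<open>The elements of the universe \<open>V\<close> over \<open>\<Q>\<close>.  The ordinal-indexed hierarchy is replaced by
  its union, which is the least class closed under forming \<open>\<Q>\<close>-valued functions.\<close>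

inductive_set qV :: "'p set \<Rightarrow> 'p qset set" for \<Q> where
  "\<lbrakk>single_valued (rcset (graph u)); snd ` rcset (graph u) \<subseteq> \<Q>; \<And>x. x \<in> qdom u \<Longrightarrow> x \<in> qV \<Q>\<rbrakk>
     \<Longrightarrow> u \<in> qV \<Q>"

lemma wf_qdom: "wf {(x, u). x \<in> qdom u}"
proof (rule wfUNIVI)
  fix P :: "'p qset \<Rightarrow> bool" and u :: "'p qset"
  assume step: "\<forall>x. (\<forall>y. (y, x) \<in> {(x, u). x \<in> qdom u} \<longrightarrow> P y) \<longrightarrow> P x"
  show "P u"
  proof (induction u)
    case (QSet g)
    have "P y" if y: "y \<in> qdom (QSet g)" for y
    proof -
      from y obtain p where "(y, p) \<in> rcset g" by (auto simp: qdom_def)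
      thus ?thesis by (rule QSet) (simp add: fsts.simps)
    qed
    thus ?case using step by blast
  qed
qed

function qsupp :: "'p qset \<Rightarrow> 'p set" where
  "qsupp u = (\<Union>x\<in>qdom u. qsupp x) \<union> {qval u x | x. x \<in> qdom u}"
  by pat_completeness auto
termination by (relation "{(x, u). x \<in> qdom u}") (auto simp: wf_qdom)

lemma qdom_mult:
  assumes "x \<in> qdom u"
  shows "({#x, v#}, {#u, v#}) \<in> mult {(x, u). x \<in> qdom u}"
    and "({#v, x#}, {#v, u#}) \<in> mult {(x, u). x \<in> qdom u}"
    and "({#x, v#}, {#v, u#}) \<in> mult {(x, u). x \<in> qdom u}"
  using one_step_implies_mult[of "{#u#}" "{#x#}" "{(x, u). x \<in> qdom u}" "{#v#}"] assms
  by (simp_all add: add_mset_commute)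

function qeq :: "'a :: chilbert_space proj qset \<Rightarrow> 'a proj qset \<Rightarrow> 'a proj"
  and qmem :: "'a proj qset \<Rightarrow> 'a proj qset \<Rightarrow> 'a proj"
where
  "qeq u v = (\<Sqinter>x\<in>qdom u. qimp (qval u x) (qmem x v)) \<sqinter> (\<Sqinter>y\<in>qdom v. qimp (qval v y) (qmem y u))"
| "qmem u v = (\<Squnion>y\<in>qdom v. qval v y \<sqinter> qeq u y)"
  by pat_completeness auto
termination
proof (relation "inv_image (mult {(x, u). x \<in> qdom u})
    (\<lambda>a. case a of Inl (u, v) \<Rightarrow> {#u, v#} | Inr (u, v) \<Rightarrow> {#u, v#})")
  show "wf (inv_image (mult {(x, u). x \<in> qdom u})
    (\<lambda>a. case a of Inl (u, v) \<Rightarrow> {#u, v#} | Inr (u, v) \<Rightarrow> {#u, v :: 'a proj qset#}))"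
    by (intro wf_inv_image wf_mult wf_qdom)
qed (auto intro: qdom_mult)

declare qsupp.simps [simp del] qeq.simps [simp del] qmem.simps [simp del]

text \<open>The bounded quantifiers; \<open>\<phi> x\<close> is the truth value of the matrix at \<open>x\<close>.\<close>

definition qall :: "'a :: chilbert_space proj qset \<Rightarrow> ('a proj qset \<Rightarrow> 'a proj) \<Rightarrow> 'a proj" where
  "qall u \<phi> = (\<Sqinter>x\<in>qdom u. qimp (qval u x) (\<phi> x))"

definition qex :: "'a :: chilbert_space proj qset \<Rightarrow> ('a proj qset \<Rightarrow> 'a proj) \<Rightarrow> 'a proj" where
  "qex u \<phi> = (\<Squnion>x\<in>qdom u. qval u x \<sqinter> \<phi> x)"

definition Or :: "'a :: chilbert_space proj qset set \<Rightarrow> 'a proj" where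
  "Or U = cdom (\<Union>u\<in>U. qsupp u)"

primrec check :: "hset \<Rightarrow> 'a :: chilbert_space proj qset" where
  "check (HSet A) = QSet (cimage (\<lambda>w. (check w, \<top>)) A)"

section \<open>Projection-valued real numbers\<close>

text \<open>The parameter \<open>c\<close> is an injective coding of the rational numbers as sets; the set-theoretic
  construction of the rationals is immaterial and is left arbitrary.\<close>

definition rat_set :: "(rat \<Rightarrow> hset) \<Rightarrow> hset" where
  "rat_set c = HSet (acset (range c))"

text \<open>The truth value of \<open>y < z\<close>, that is, of the membership of the pair \<open>(y, z)\<close> in the
  order relation of the rationals, transferred from sets to projection-valued sets.  For
  \<open>y = check (c r)\<close> and \<open>z = check (c s)\<close> it is \<open>\<top>\<close> or \<open>\<bottom>\<close>
  according to whether \<open>r < s\<close>.\<close>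

definition qless ::
  "(rat \<Rightarrow> hset) \<Rightarrow> 'a :: chilbert_space proj qset \<Rightarrow> 'a proj qset \<Rightarrow> 'a proj" where
  "qless c y z = (\<Squnion>(r, s)\<in>{(r, s). r < s}. qeq y (check (c r)) \<sqinter> qeq z (check (c s)))"

definition is_real_truth :: "(rat \<Rightarrow> hset) \<Rightarrow> 'a :: chilbert_space proj qset \<Rightarrow> 'a proj" where
  "is_real_truth c x =
     (let QQ = check (rat_set c) in
        qall x (\<lambda>z. qmem z QQ) \<sqinter>
        qex QQ (\<lambda>y. qmem y x) \<sqinter>
        qex QQ (\<lambda>y. - qmem y x) \<sqinter>
        qall QQ (\<lambda>y. qiff (qmem y x) (qall QQ (\<lambda>z. qimp (qless c y z) (qmem z x)))))"

definition qreals :: "'a :: chilbert_space proj set \<Rightarrow> (rat \<Rightarrow> hset) \<Rightarrow> 'a proj qset set" where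
  "qreals \<Q> c = {u \<in> qV \<Q>. qdom u = {check (c r) | r. True} \<and> is_real_truth c u = \<top>}"

end

(* On the range of [[u = v]] one has u(r) x = v(r) x for every rational r, since P <=> Q projects
   onto the equalizer of P and Q.  Hence on the range E of the left-hand side all the u_i(r) coincide
   for fixed r.  As u_i is monotone in r, u_i(r) u_j(s) x = u_i(r) u_i(s) x = u_i(min r s) x for x in E,
   which no longer depends on i.  So E is invariant under all the u_i(r), and they commute
   on it: E is itself one of the projections whose supremum defines the commutator domain. *)

theory Submission
  imports Defs
begin

section \<open>Projections\<close>

lemma proj_apply_add: "proj_apply P (x + y) = proj_apply P x + proj_apply P y"
  and proj_apply_diff: "proj_apply P (x - y) = proj_apply P x - proj_apply P y"
  and proj_apply_zero [simp]: "proj_apply P 0 = 0"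
  using is_projection_proj_apply[of P]
  by (simp_all add: is_projection_def bounded_linear.linear linear_add linear_diff linear_0)

lemma proj_apply_scaleC: "proj_apply P (scaleC a x) = scaleC a (proj_apply P x)"
  using is_projection_proj_apply[of P] by (simp add: is_projection_def)

lemma proj_apply_idem [simp]: "proj_apply P (proj_apply P x) = proj_apply P x"
  using is_projection_proj_apply[of P] by (simp add: is_projection_def fun_eq_iff)

lemma cinner_proj_apply: "cinner (proj_apply P x) y = cinner x (proj_apply P y)"
  using is_projection_proj_apply[of P] by (simp add: is_projection_def)

lemma mem_proj_ran: "x \<in> proj_ran P \<longleftrightarrow> proj_apply P x = x"
  unfolding proj_ran_def by (auto intro: rev_image_eqI[of x])

lemma proj_apply_mem_ran [simp]: "proj_apply P x \<in> proj_ran P"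
  by (simp add: mem_proj_ran)

lemma closed_csubspace_vimage:
  assumes "closed_csubspace M"
  shows "closed_csubspace {x. proj_apply P x \<in> M}"
proof -
  have "bounded_linear (proj_apply P)"
    using is_projection_proj_apply[of P] by (simp add: is_projection_def)
  then have "continuous_on UNIV (proj_apply P)"
    by (rule linear_continuous_on)
  moreover have "closed M"
    using closed_csubspaceD(1)[OF assms] .
  ultimately have "closed {x. proj_apply P x \<in> M}"
    using continuous_closed_vimage[of M "proj_apply P"]
    by (simp add: vimage_def continuous_on_eq_continuous_at)
  then show ?thesis
    using closed_csubspaceD[OF assms]
    by (simp add: closed_csubspace_def proj_apply_add proj_apply_scaleC)
qed

lemma cinner_left_eqI: "(\<And>y. cinner y a = cinner y b) \<Longrightarrow> a = (b :: 'a :: complex_inner)"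
  by (metis cinner_diff_right cinner_self_eq_0 eq_iff_diff_eq_0)

text \<open>\<open>Q\<close> fixes every vector in the range of \<open>P\<close>; the second
  equation is the adjoint of the first.\<close>

lemma proj_apply_le:
  assumes "P \<le> Q"
  shows "proj_apply Q (proj_apply P x) = proj_apply P x"
    and "proj_apply P (proj_apply Q x) = proj_apply P x"
proof -
  show *: "proj_apply Q (proj_apply P y) = proj_apply P y" for y
    using assms by (metis less_eq_proj_def mem_proj_ran proj_apply_mem_ran subsetD)
  show "proj_apply P (proj_apply Q x) = proj_apply P x"
    by (rule cinner_left_eqI) (metis * cinner_proj_apply)
qed

text \<open>This describes the Sasaki arrow. The preimage is a closed subspace containing both
  joined ranges, since P kills one and fixes the other. Conversely, every x in it splits into x - P
  x and P x.\<close>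

lemma proj_ran_qimp: "proj_ran (qimp P Q) = {x. proj_apply P x \<in> proj_ran Q}"
proof
  have "proj_ran (- P) \<union> proj_ran (P \<sqinter> Q) \<subseteq> {x. proj_apply P x \<in> proj_ran Q}"
    using closed_csubspaceD(2)[OF closed_csubspace_ran]
    by (auto simp: mem_proj_ran[of _ "- P"] proj_apply_uminus proj_ran_inf mem_proj_ran[of _ P])
  then show "proj_ran (qimp P Q) \<subseteq> {x. proj_apply P x \<in> proj_ran Q}"
    unfolding qimp_def proj_ran_sup
    by (rule hull_minimal) (rule closed_csubspace_vimage[OF closed_csubspace_ran])
next
  show "{x. proj_apply P x \<in> proj_ran Q} \<subseteq> proj_ran (qimp P Q)"
  proof
    fix x assume "x \<in> {x. proj_apply P x \<in> proj_ran Q}"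
    then have "proj_apply P x \<in> proj_ran (P \<sqinter> Q)"
      by (simp add: proj_ran_inf)
    moreover have "x - proj_apply P x \<in> proj_ran (- P)"
      by (simp add: mem_proj_ran proj_apply_uminus proj_apply_diff)
    moreover have "- P \<le> qimp P Q" "P \<sqinter> Q \<le> qimp P Q"
      by (simp_all add: qimp_def)
    ultimately have "(x - proj_apply P x) + proj_apply P x \<in> proj_ran (qimp P Q)"
      unfolding less_eq_proj_def by (intro closed_csubspaceD(3)[OF closed_csubspace_ran]) auto
    then show "x \<in> proj_ran (qimp P Q)" by simp
  qed
qed

lemma qimp_top [simp]: "qimp \<top> P = P" and qimp_bot [simp]: "qimp \<bottom> P = \<top>"
  using closed_csubspaceD(2)[OF closed_csubspace_ran, of P]
  by (simp_all add: proj_ran_qimp proj_apply_top proj_apply_bot proj_ran_top flip: proj_ran_inject)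

text \<open>By \<open>proj_ran_qimp\<close>, membership means Q P x = P x and P Q x = Q x. This
  forces P x = Q x even when P and Q do not commute.\<close>

lemma proj_ran_qiff: "proj_ran (qiff P Q) = {x. proj_apply P x = proj_apply Q x}"
proof -
  have "proj_apply P x = proj_apply Q x"
    if "proj_apply Q (proj_apply P x) = proj_apply P x"
      "proj_apply P (proj_apply Q x) = proj_apply Q x" for x
  proof -
    \<comment> \<open>Self-adjointness makes the inner products of P x with Q x, of Q x with P x, of
      x with P x and of x with Q x all equal, so P x - Q x has norm 0.\<close>
    have "cinner (proj_apply P x) (proj_apply Q x) = cinner x (proj_apply Q x)"
      "cinner (proj_apply P x) (proj_apply Q x) = cinner x (proj_apply P x)"
      "cinner (proj_apply Q x) (proj_apply P x) = cinner x (proj_apply P x)"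
      using that by (metis cinner_proj_apply proj_apply_idem)+
    then have "cinner (proj_apply P x - proj_apply Q x) (proj_apply P x - proj_apply Q x) = 0"
      by (simp add: cinner_diff_left cinner_diff_right cinner_proj_apply)
    then show ?thesis
      using cinner_self_eq_0 by fastforce
  qed
  then show ?thesis
    unfolding qiff_def proj_ran_inf proj_ran_qimp mem_proj_ran
    by (auto, metis proj_apply_idem)
qed

lemma qiff_eq_top_iff: "qiff P Q = \<top> \<longleftrightarrow> P = Q"
  using proj_ran_inject[of "qiff P Q" \<top>]
  by (auto simp: proj_ran_qiff proj_ran_top proj_apply_inject set_eq_iff simp flip: fun_eq_iff)

section \<open>Commuting projections and the commutator domain\<close>

lemma commutes_inf_apply:
  assumes "commutes P Q"
  shows "proj_apply (P \<sqinter> Q) x = proj_apply P (proj_apply Q x)"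
proof -
  have comm: "proj_apply P (proj_apply Q y) = proj_apply Q (proj_apply P y)" for y
    using assms by (simp add: commutes_def fun_eq_iff)
  have mem: "proj_apply P (proj_apply Q x) \<in> proj_ran (P \<sqinter> Q)"
    by (metis IntI comm proj_apply_mem_ran proj_ran_inf)
  \<comment> \<open>The meet absorbs \<open>P\<close> and then \<open>Q\<close>, while it fixes P Q
    x, which lies in both ranges.\<close>
  have "proj_apply (P \<sqinter> Q) (proj_apply P (proj_apply Q x)) = proj_apply (P \<sqinter> Q) x"
    by (simp add: proj_apply_le)
  then show ?thesis
    using mem by (simp add: mem_proj_ran)
qed

text \<open>Invariance means E P E = P E. Taking adjoints gives E P E = E P, hence E P = P
  E.\<close>

lemma commutes_if_invariant:
  assumes "\<And>x. x \<in> proj_ran E \<Longrightarrow> proj_apply P x \<in> proj_ran E"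
  shows "commutes E P"
proof -
  have *: "proj_apply E (proj_apply P (proj_apply E x)) = proj_apply P (proj_apply E x)" for x
    using assms[OF proj_apply_mem_ran] by (simp add: mem_proj_ran)
  have "proj_apply E (proj_apply P x) = proj_apply P (proj_apply E x)" for x
    by (rule cinner_left_eqI) (metis * cinner_proj_apply)
  then show ?thesis
    by (simp add: commutes_def fun_eq_iff)
qed

lemma commutes_sym: "commutes P Q \<Longrightarrow> commutes Q P"
  by (simp add: commutes_def)

text \<open>By invariance \<open>E\<close> commutes with every member of \<open>A\<close>, so each
  \<open>P \<sqinter> E\<close> acts as P E, and (P E)(Q E) = P Q E. Hence \<open>E\<close> is one
  of the projections joined in \<open>cdom A\<close>.\<close>

lemma le_cdomI:
  assumes inv: "\<And>P x. P \<in> A \<Longrightarrow> x \<in> proj_ran E \<Longrightarrow> proj_apply P x \<in> proj_ran E"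
    and comm: "\<And>P Q x. P \<in> A \<Longrightarrow> Q \<in> A \<Longrightarrow> x \<in> proj_ran E \<Longrightarrow>
      proj_apply P (proj_apply Q x) = proj_apply Q (proj_apply P x)"
  shows "E \<le> cdom A"
  unfolding cdom_def
proof (intro Sup_upper CollectI conjI ballI)
  have E: "commutes E P" if "P \<in> A" for P
    using inv[OF that] by (rule commutes_if_invariant)
  then show "E \<in> commutant A"
    by (simp add: commutant_def)
  fix P Q assume PQ: "P \<in> A" "Q \<in> A"
  have inf: "proj_apply (R \<sqinter> E) x = proj_apply R (proj_apply E x)" if "R \<in> A" for R x
    using that by (intro commutes_inf_apply commutes_sym[OF E])
  have fix_E: "proj_apply E (proj_apply R (proj_apply E x)) = proj_apply R (proj_apply E x)"
    if "R \<in> A" for R x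
    using inv[OF that proj_apply_mem_ran] by (simp add: mem_proj_ran)
  show "commutes (P \<sqinter> E) (Q \<sqinter> E)"
    unfolding commutes_def using PQ
    by (auto simp: fun_eq_iff inf fix_E intro: comm)
qed

section \<open>Check names\<close>

lemma hset_eq_iff: "v = w \<longleftrightarrow> rcset (elts v) = rcset (elts w)"
  by (metis hset.expand rcset_inject)

lemma graph_check: "rcset (graph (check v)) = (\<lambda>w. (check w, \<top>)) ` rcset (elts v)"
  by (cases v) (simp add: cimage.rep_eq)

lemma qdom_check: "qdom (check v) = check ` rcset (elts v)"
  by (simp add: qdom_def graph_check image_image)

lemma qval_check: "x \<in> qdom (check v) \<Longrightarrow> qval (check v) x = \<top>"
  unfolding qval_def qdom_check graph_check by (rule the_equality) auto

lemma qeq_commute: "qeq u v = qeq v u"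
  unfolding qeq.simps[of u] qeq.simps[of v] by (rule inf_commute)

lemma qmem_check_right: "qmem u (check w) = (\<Squnion>y\<in>rcset (elts w). qeq u (check y))"
  unfolding qmem.simps by (simp add: qval_check) (simp add: qdom_check image_image)

text \<open>Stated for one fixed \<open>v\<close>, so that the induction hypothesis of
  \<open>qeq_check\<close> can serve as the premise.\<close>

lemma Sup_qeq_check:
  fixes W :: "hset set"
  assumes "\<And>w. qeq (check v) (check w) = (if v = w then \<top> else \<bottom> :: 'a :: chilbert_space proj)"
  shows "(\<Squnion>w\<in>W. qeq (check v) (check w)) = (if v \<in> W then \<top> else \<bottom> :: 'a proj)"
proof (cases "v \<in> W")
  case True
  then have "(\<top> :: 'a proj) \<le> (\<Squnion>w\<in>W. qeq (check v) (check w))"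
    by (intro SUP_upper2[of v]) (auto simp: assms)
  with True show ?thesis by (simp add: top_unique)
next
  case False
  then have "(\<Squnion>w\<in>W. qeq (check v) (check w)) \<le> (\<bottom> :: 'a proj)"
    by (intro SUP_least) (auto simp: assms)
  with False show ?thesis by (simp add: bot_unique)
qed

lemma Inf_if_top_bot:
  "(\<Sqinter>x\<in>A. if P x then \<top> else \<bottom>) = (if \<forall>x\<in>A. P x then \<top> else (\<bottom> :: 'a :: complete_lattice))"
proof (cases "\<forall>x\<in>A. P x")
  case False
  then obtain a where "a \<in> A" "\<not> P a" by blast
  then have "(\<Sqinter>x\<in>A. if P x then \<top> else \<bottom> :: 'a) \<le> \<bottom>"
    by (intro INF_lower2[of a]) auto
  with False show ?thesis by (simp only: bot_unique if_False)
qed simp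

text \<open>By induction both families of membership values in the equality are two-valued, so their
  infimum decides extensional equality.\<close>

lemma qeq_check: "qeq (check v) (check w) = (if v = w then \<top> else \<bottom> :: 'a :: chilbert_space proj)"
proof (induction v arbitrary: w)
  case (HSet V)
  have qmem: "qmem (check x) (check w) = (if x \<in> rcset (elts w) then \<top> else \<bottom> :: 'a proj)"
    if "x \<in> rcset V" for x w
    using HSet[of x] that by (simp add: qmem_check_right Sup_qeq_check)
  \<comment> \<open>Here \<open>y\<close> is arbitrary and the induction hypothesis speaks only of
    elements of \<open>V\<close>, so \<open>qeq_commute\<close> brings such an element into the
    first argument.\<close>
  have qmem': "qmem (check y) (check (HSet V)) = (if y \<in> rcset V then \<top> else \<bottom> :: 'a proj)" for y
  proof -
    have "qeq (check y) (check x) = (if x = y then \<top> else \<bottom> :: 'a proj)" if "x \<in> rcset V" for x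
      using HSet[of x y] that by (simp add: qeq_commute)
    then have "qmem (check y) (check (HSet V)) = (\<Squnion>x\<in>rcset V. if x = y then \<top> else \<bottom> :: 'a proj)"
      by (simp add: qmem_check_right del: check.simps)
    also have "\<dots> = (if y \<in> rcset V then \<top> else \<bottom>)"
      by (auto intro!: antisym SUP_least intro: SUP_upper2[of y])
    finally show ?thesis .
  qed
  have "qeq (check (HSet V)) (check w) =
      (\<Sqinter>x\<in>rcset V. qmem (check x) (check w)) \<sqinter>
      (\<Sqinter>y\<in>rcset (elts w). qmem (check y) (check (HSet V)) :: 'a proj)"
    unfolding qeq.simps[of "check (HSet V)"]
    by (auto simp: qdom_check qval_check image_image simp del: check.simps
        intro!: arg_cong2[of _ _ _ _ inf] INF_cong)
  also have "\<dots> = (\<Sqinter>x\<in>rcset V. if x \<in> rcset (elts w) then \<top> else \<bottom>) \<sqinter>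
      (\<Sqinter>y\<in>rcset (elts w). if y \<in> rcset V then \<top> else \<bottom>)"
    by (simp add: qmem qmem' del: check.simps)
  also have "\<dots> = (if HSet V = w then \<top> else \<bottom>)"
    unfolding Inf_if_top_bot by (auto simp: hset_eq_iff)
  finally show ?case .
qed

text \<open>On the zero space \<top> = \<bottom>, so truth values cannot separate names there; the
  names are compared through their domains instead.\<close>

lemma inj_check: "inj (check :: hset \<Rightarrow> 'a :: chilbert_space proj qset)"
proof (rule injI)
  show "v = w" if "check v = (check w :: 'a proj qset)" for v w
    using that
  proof (induction v arbitrary: w)
    case (HSet V)
    have "(check :: hset \<Rightarrow> 'a proj qset) ` rcset V = check ` rcset (elts w)"
      using arg_cong[OF HSet.prems, of qdom] unfolding qdom_check by simp
    then have "rcset V = rcset (elts w)"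
      using HSet.IH by (metis (no_types, opaque_lifting) imageE imageI subsetI subset_antisym)
    then show ?case
      by (simp add: hset_eq_iff)
  qed
qed

text \<open>The inclusion can be strict: the check name of the empty set has empty support.\<close>

lemma qsupp_check: "qsupp (check v) \<subseteq> {\<top>}"
proof (induction v)
  case (HSet V)
  then show ?case
    unfolding qsupp.simps[of "check (HSet V)"]
    by (auto simp: qdom_check qval_check simp del: check.simps)
qed

section \<open>Projection-valued reals\<close>

lemma qdom_check_rat_set: "qdom (check (rat_set c)) = range (\<lambda>r. check (c r))"
proof -
  have "rcset (elts (rat_set c)) = range c"
    by (simp add: rat_set_def acset_inverse)
  then show ?thesis by (auto simp: qdom_check)
qed

text \<open>Only the pair \<open>(r, s)\<close> itself can contribute to the supremum, because
  distinct rationals have distinct codes and their names have equality value \<bottom>.\<close>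

lemma qless_check:
  assumes "inj c"
  shows "qless c (check (c r)) (check (c s)) = (if r < s then \<top> else \<bottom>)"
proof (cases "r < s")
  case True
  then have "\<top> \<le> qless c (check (c r)) (check (c s))"
    unfolding qless_def by (intro SUP_upper2[of "(r, s)"]) (auto simp: qeq_check)
  with True show ?thesis by (simp add: top_unique)
next
  case False
  then have "qless c (check (c r)) (check (c s)) \<le> \<bottom>"
    unfolding qless_def using assms by (intro SUP_least) (auto simp: qeq_check inj_eq)
  with False show ?thesis by (simp add: bot_unique)
qed

context
  fixes c :: "rat \<Rightarrow> hset" and u :: "'h :: chilbert_space proj qset"
  assumes c: "inj c" and dom: "qdom u = range (\<lambda>r. check (c r))"
begin

text \<open>In the supremum defining membership, the names of all rationals other than
  \<open>r\<close> drop out by \<open>qeq_check\<close>.\<close>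

lemma qmem_check_rat: "qmem (check (c r)) u = qval u (check (c r))"
proof -
  have "qmem (check (c r)) u = (\<Squnion>s. qval u (check (c s)) \<sqinter> (if r = s then \<top> else \<bottom>))"
    unfolding qmem.simps dom using c by (simp add: image_image qeq_check inj_eq)
  also have "\<dots> = qval u (check (c r))"
    by (intro antisym SUP_least SUP_upper2[of r]) auto
  finally show ?thesis .
qed

text \<open>The supports of the check names in the domain account for \<top>; the rest of the
  support are the values of \<open>u\<close>.\<close>

lemma qsupp_rat: "qsupp u \<subseteq> insert \<top> (range (\<lambda>r. qval u (check (c r))))"
proof -
  have "(\<Union>x\<in>qdom u. qsupp x) \<subseteq> {\<top>}"
    unfolding dom using qsupp_check by blast
  then show ?thesis
    unfolding qsupp.simps[of u] by (auto simp: dom)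
qed

text \<open>The last conjunct of \<open>is_real_truth\<close> is a right continuity condition: it
  forces the value at \<open>r\<close> to be the infimum of the values at all rationals above
  \<open>r\<close>.\<close>

lemma qval_mono_if_is_real_truth:
  assumes "is_real_truth c u = \<top>" and "r \<le> s"
  shows "qval u (check (c r)) \<le> qval u (check (c s))"
proof (cases "r = s")
  case False
  define U where "U s = qval u (check (c s))" for s
  have "qall (check (rat_set c)) \<phi> = (\<Sqinter>r. \<phi> (check (c r)))" for \<phi> :: "'h proj qset \<Rightarrow> 'h proj"
    unfolding qall_def
    by (subst INF_cong[OF refl, where D = \<phi>])
      (auto simp: qval_check qdom_check_rat_set image_image)
  then have "(\<Sqinter>r. qiff (U r) (\<Sqinter>s. qimp (if r < s then \<top> else \<bottom>) (U s))) = \<top>"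
    using assms(1) c
    by (simp add: is_real_truth_def Let_def inf_eq_top_iff qless_check qmem_check_rat U_def)
  then have "qiff (U r) (\<Sqinter>s. qimp (if r < s then \<top> else \<bottom>) (U s)) = \<top>"
    by (metis (no_types, lifting) INF_top_conv(1) UNIV_I)
  \<comment> \<open>An equivalence of value \<top> is an equality. The entries with s \<le> r are
    \<top>, which leaves the infimum over s > r.\<close>
  then have "U r = (\<Sqinter>s. qimp (if r < s then \<top> else \<bottom>) (U s))"
    by (simp only: qiff_eq_top_iff)
  also have "\<dots> \<le> U s"
    using assms(2) False by (intro INF_lower2[of s]) auto
  finally show ?thesis by (simp add: U_def)
qed simp

end

lemma qrealsD:
  assumes "u \<in> qreals \<Q> c"
  shows "qdom u = range (\<lambda>r. check (c r))" and "is_real_truth c u = \<top>"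
  using assms by (auto simp: qreals_def)

text \<open>By monotonicity the two projections are comparable, and the product of comparable
  projections, in either order, is the smaller one.\<close>

lemma qval_qreals_apply_qval:
  assumes "inj c" and "u \<in> qreals \<Q> c"
  shows "proj_apply (qval u (check (c r))) (proj_apply (qval u (check (c s))) x)
    = proj_apply (qval u (check (c (min r s)))) x"
proof -
  note mono = qval_mono_if_is_real_truth[OF assms(1) qrealsD[OF assms(2)]]
  show ?thesis
  proof (cases "r \<le> s")
    case True
    then show ?thesis
      unfolding min_absorb1[OF True] by (rule proj_apply_le(2)[OF mono])
  next
    case False
    then have "s \<le> r" by simp
    then show ?thesis
      unfolding min_absorb2[OF \<open>s \<le> r\<close>] by (rule proj_apply_le(1)[OF mono])
  qed
qed

text \<open>The two domains agree, and the name of \<open>r\<close> belongs to a real with that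
  real's value at \<open>r\<close>. So the two families of implications in the equality pair off
  into equivalences, whose ranges are equalizers.\<close>

lemma proj_ran_qeq_qreals:
  assumes "inj c" and u: "u \<in> qreals \<Q> c" and v: "v \<in> qreals \<Q> c"
  shows "proj_ran (qeq u v) =
    {x. \<forall>r. proj_apply (qval u (check (c r))) x = proj_apply (qval v (check (c r))) x}"
proof -
  note dom = qrealsD(1)[OF u] qrealsD(1)[OF v]
  note mem = qmem_check_rat[OF assms(1) qrealsD(1)[OF u]] qmem_check_rat[OF assms(1) qrealsD(1)[OF v]]
  have "qeq u v = (\<Sqinter>r. qiff (qval u (check (c r))) (qval v (check (c r))))"
    unfolding qeq.simps[of u] dom image_image mem qiff_def by (simp add: INF_inf_distrib)
  then show ?thesis
    by (auto simp: proj_ran_Inf proj_ran_qiff)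
qed

section \<open>Chains of equalities and the commutator domain\<close>

theorem theorem5p8:
  fixes \<Q> :: "'h :: chilbert_space proj set"
    and c :: "rat \<Rightarrow> hset"
    and n :: nat
    and u :: "nat \<Rightarrow> 'h proj qset"
  assumes "is_logic \<Q>"
    and "inj c"
    and "\<And>i. i \<in> {1..n} \<Longrightarrow> u i \<in> qreals \<Q> c"
  shows "(\<Sqinter>i\<in>{1..<n}. qeq (u i) (u (i + 1))) \<le> Or (u ` {1..n})"
proof -
  define E where "E = (\<Sqinter>i\<in>{1..<n}. qeq (u i) (u (i + 1)))"
  define U where "U i r = proj_apply (qval (u i) (check (c r)))" for i r
  define A where "A = (\<Union>v\<in>u ` {1..n}. qsupp v)"
  have U_U: "U i r (U i s x) = U i (min r s) x" if "i \<in> {1..n}" for i r s x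
    unfolding U_def using qval_qreals_apply_qval[OF assms(2) assms(3)[OF that]] .
  have mem_E: "x \<in> proj_ran E \<longleftrightarrow> (\<forall>i\<in>{1..<n}. \<forall>r. U i r x = U (i + 1) r x)" for x
    by (simp add: E_def U_def proj_ran_Inf proj_ran_qeq_qreals[OF assms(2) assms(3) assms(3)])
  \<comment> \<open>Equality of neighbours propagates upwards from index 1, which becomes a common
    reference for all the reals.\<close>
  have U_1: "U i r x = U 1 r x" if x: "x \<in> proj_ran E" and i: "i \<in> {1..n}" for i r x
  proof -
    have "1 \<le> i" "i \<le> n" using i by auto
    then show ?thesis
    proof (induction i rule: dec_induct)
      case (step i)
      then show ?case using x \<open>\<And>x. x \<in> proj_ran E \<longleftrightarrow> _ x\<close> by auto
    qed simp
  qed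
  have E_iff: "x \<in> proj_ran E \<longleftrightarrow> (\<forall>i\<in>{1..n}. \<forall>r. U i r x = U 1 r x)" for x
  proof
    assume *: "\<forall>i\<in>{1..n}. \<forall>r. U i r x = U 1 r x"
    have "U i r x = U (i + 1) r x" if "i \<in> {1..<n}" for i r
      using *[rule_format, of i r] *[rule_format, of "i + 1" r] that by simp
    then show "x \<in> proj_ran E"
      by (simp add: mem_E)
  qed (use U_1 in blast)
  have A_cases: "P = \<top> \<or> (\<exists>i\<in>{1..n}. \<exists>r. proj_apply P = U i r)" if P: "P \<in> A" for P
  proof -
    obtain i where i: "i \<in> {1..n}" "P \<in> qsupp (u i)"
      using P by (auto simp: A_def)
    then have "P \<in> insert \<top> (range (\<lambda>r. qval (u i) (check (c r))))"
      using qsupp_rat[OF assms(2) qrealsD(1)[OF assms(3)]] by blast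
    then show ?thesis
      using i by (auto simp: U_def)
  qed
  \<comment> \<open>On the range of \<open>E\<close> the inner index \<open>j\<close> may be
    replaced by \<open>i\<close>, after which \<open>U_U\<close> applies. The result depends on
    neither index and is symmetric in \<open>r\<close> and \<open>s\<close>, so it serves for both
    invariance and commutation.\<close>
  have UU_E: "U i r (U j s x) = U 1 (min r s) x"
    if "x \<in> proj_ran E" "i \<in> {1..n}" "j \<in> {1..n}" for i j r s x
    by (metis U_1 U_U that)
  have "E \<le> cdom A"
  proof (rule le_cdomI)
    show "proj_apply P x \<in> proj_ran E" if "P \<in> A" "x \<in> proj_ran E" for P x
      using A_cases[OF that(1)]
    proof
      assume "\<exists>i\<in>{1..n}. \<exists>r. proj_apply P = U i r"
      then obtain i r where i: "i \<in> {1..n}" and P: "proj_apply P = U i r" by blast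
      \<comment> \<open>The reference index 1 must itself be admissible in \<open>UU_E\<close>; the
        presence of \<open>i\<close> ensures this. For n = 0 the set \<open>A\<close> is
        empty.\<close>
      have "1 \<in> {1..n}" using i by simp
      then show ?thesis
        unfolding E_iff P using UU_E[OF that(2)] i by simp
    qed (simp add: proj_apply_top that(2))
    show "proj_apply P (proj_apply Q x) = proj_apply Q (proj_apply P x)"
      if "P \<in> A" "Q \<in> A" "x \<in> proj_ran E" for P Q x
      using A_cases[OF that(1)] A_cases[OF that(2)] UU_E[OF that(3)]
      by (auto simp: proj_apply_top min.commute)
  qed
  then show ?thesis
    by (simp add: E_def A_def Or_def)
qed

end
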